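(* Let $V$ be a finite-dimensional real vector space, let $\Sigma\subset\mathbb{Z}^N$ be simply connected and let $s:\Sigma\to\mathbb{P}(V)$ be a regular map. Then $s$ is Koenigs if and only if $s$ has an affine lift $F\in\Gamma s$ which admits a Koenigs dual $\check{F}$. In this case, one may take the $1$-form of the Koenigs net to be $\eta=\mathrm{d}\check{F}\curlywedge F$, that is, $\eta_{ji}=(\check F_j-\check F_i)\wedge\tfrac12(F_i+F_j)$ on each edge $ij$.
   Context: Domain: an edge $ij$ of $\Sigma\subset\mathbb{Z}^N$ is a pair of points of $\Sigma$ differing by a standard unit vector; a quadrilateral is an elementary square with all four vertices $i,j,k,\ell$ (in cyclic order) in $\Sigma$. $\Sigma$ is simply connected if any two points are joined by an edge-path in $\Sigma$ and any two edge-paths in $\Sigma$ with the same end-points are related by finitely many moves of the types: (a) insert or delete a back-and-forth step, replacing $i$ by $(iji)$ for an edge $ij$; (b) replace $(k\ell i)$ by $(kji)$ on a quadrilateral with cyclically ordered vertices $i,j,k,\ell$. A $1$-form $\alpha$ with values in a vector space assigns a value $\alpha_{ji}=-\alpha_{ij}$ to each oriented edge from $i$ to $j$. It is closed ($\mathrm{d}\alpha=0$) if $\alpha_{i\ell}+\alpha_{\ell k}+\alpha_{kj}+\alpha_{ji}=0$ on every quadrilateral. For a function $f$, $\mathrm{d}f_{ji}=f_j-f_i$. A map $s:\Sigma\to\mathbb{P}(V)$ is viewed as a line subbundle of $\Sigma\times V$; $\Gamma s$ denotes its sections. Regular: on each quadrilateral, $s_i,s_j,s_k,s_\ell$ are pairwise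 distinct and $\dim(s_i+s_j+s_k+s_\ell)\ge3$. $s$ is Koenigs if there is a closed never-zero $1$-form $\eta$ with values in $\Lambda^2V$ such that $\eta_{ji}\in s_j\wedge s_i$ on each edge $ij$. An affine lift of $s$ is a section $F\in\Gamma s$ with $\alpha(F)\equiv-1$ for some $\alpha\in V^*$; thus $F$ takes values in the affine hyperplane $\mathbb{A}=\{v\in V: \alpha(v)=-1\}$. A Koenigs dual of $F:\Sigma\to\mathbb{A}$ is a map $\check F:\Sigma\to\mathbb{A}$ such that (1) $\check F$ is edge-parallel to $F$: on each edge, $\mathrm{d}\check F_{ij}$ is a non-zero real multiple of $\mathrm{d}F_{ij}$; (2) opposite diagonals are parallel: on each quadrilateral, $(F_k-F_i)\wedge(\check F_\ell-\check F_j)=0$ and $(F_\ell-F_j)\wedge(\check F_k-\check F_i)=0$.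
   Formalization: A Koenigs dual is required to have non-zero increment on every edge (not only a non-zero scalar factor); otherwise a constant map on a single edge, with its constant lift as its own dual, would be a counterexample. *)

theory Defs
  imports "HOL-Analysis.Analysis"
begin

section \<open>The exterior square of a finite-dimensional real vector space\<close>

typedef (overloaded) 'v dual = "{\<phi> :: 'v::real_vector \<Rightarrow> real. linear \<phi>}"
  morphisms dual_apply Dual
  by (rule exI[of _ "\<lambda>_. 0"]) (simp add: linear_iff)

setup_lifting type_definition_dual

instantiation dual :: (real_vector) real_vector
begin

lift_definition zero_dual :: "'a dual" is "\<lambda>_. 0"
  by (simp add: linear_iff)
lift_definition plus_dual :: "'a dual \<Rightarrow> 'a dual \<Rightarrow> 'a dual" is "\<lambda>\<phi> \<psi> v. \<phi> v + \<psi> v"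
  by (simp add: linear_iff algebra_simps)
lift_definition uminus_dual :: "'a dual \<Rightarrow> 'a dual" is "\<lambda>\<phi> v. - \<phi> v"
  by (simp add: linear_iff)
lift_definition minus_dual :: "'a dual \<Rightarrow> 'a dual \<Rightarrow> 'a dual" is "\<lambda>\<phi> \<psi> v. \<phi> v - \<psi> v"
  by (simp add: linear_iff algebra_simps)
lift_definition scaleR_dual :: "real \<Rightarrow> 'a dual \<Rightarrow> 'a dual" is "\<lambda>c \<phi> v. c * \<phi> v"
  by (simp add: linear_iff algebra_simps)

instance
  by standard (transfer, simp add: fun_eq_iff algebra_simps)+

end

text \<open>
  For finite-dimensional \<open>V\<close>, the space \<open>\<Lambda>\<^sup>2V\<close> is the space of alternating bilinear forms on
  \<open>V\<^sup>*\<close>, with \<open>(v \<and> w)(\<phi>, \<psi>) = \<phi>(v) \<psi>(w) - \<phi>(w) \<psi>(v)\<close>.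
\<close>

typedef (overloaded) 'v bivector =
    "{\<omega> :: 'v::real_vector dual \<Rightarrow> 'v dual \<Rightarrow> real. bilinear \<omega> \<and> (\<forall>\<phi>. \<omega> \<phi> \<phi> = 0)}"
  morphisms bivector_apply Bivector
  by (rule exI[of _ "\<lambda>_ _. 0"]) (simp add: bilinear_def linear_iff)

setup_lifting type_definition_bivector

instantiation bivector :: (real_vector) real_vector
begin

lift_definition zero_bivector :: "'a bivector" is "\<lambda>_ _. 0"
  by (simp add: bilinear_def linear_iff)
lift_definition plus_bivector :: "'a bivector \<Rightarrow> 'a bivector \<Rightarrow> 'a bivector"
  is "\<lambda>\<omega> \<theta> \<phi> \<psi>. \<omega> \<phi> \<psi> + \<theta> \<phi> \<psi>"
  by (simp add: bilinear_def linear_iff algebra_simps)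
lift_definition uminus_bivector :: "'a bivector \<Rightarrow> 'a bivector" is "\<lambda>\<omega> \<phi> \<psi>. - \<omega> \<phi> \<psi>"
  by (simp add: bilinear_def linear_iff)
lift_definition minus_bivector :: "'a bivector \<Rightarrow> 'a bivector \<Rightarrow> 'a bivector"
  is "\<lambda>\<omega> \<theta> \<phi> \<psi>. \<omega> \<phi> \<psi> - \<theta> \<phi> \<psi>"
  by (simp add: bilinear_def linear_iff algebra_simps)
lift_definition scaleR_bivector :: "real \<Rightarrow> 'a bivector \<Rightarrow> 'a bivector"
  is "\<lambda>c \<omega> \<phi> \<psi>. c * \<omega> \<phi> \<psi>"
  by (simp add: bilinear_def linear_iff algebra_simps)

instance
  by standard (transfer, simp add: fun_eq_iff algebra_simps)+

end

lift_definition wedge :: "'v::real_vector \<Rightarrow> 'v \<Rightarrow> 'v bivector"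
  is "\<lambda>v w \<phi> \<psi>. dual_apply \<phi> v * dual_apply \<psi> w - dual_apply \<phi> w * dual_apply \<psi> v"
  by (simp add: bilinear_def linear_iff plus_dual.rep_eq scaleR_dual.rep_eq algebra_simps)

lemma linear_dual_apply: "linear (dual_apply \<phi>)"
  using dual_apply by blast

lemma bilinear_wedge: "bilinear wedge"
  by (simp add: bilinear_def linear_iff bivector_apply_inject[symmetric] fun_eq_iff
      wedge.rep_eq plus_bivector.rep_eq scaleR_bivector.rep_eq
      linear_add[OF linear_dual_apply] linear_scale[OF linear_dual_apply] algebra_simps)

lemma wedge_self: "wedge v v = 0"
  by (simp add: bivector_apply_inject[symmetric] fun_eq_iff wedge.rep_eq zero_bivector.rep_eq)

lemma wedge_eq_0_iff: "wedge v w = 0 \<longleftrightarrow> v = 0 \<or> w \<in> span {v}"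
proof
  assume "wedge v w = 0"
  then have W: "\<phi> v * \<psi> w = \<phi> w * \<psi> v" if "linear \<phi>" "linear \<psi>" for \<phi> \<psi> :: "'a \<Rightarrow> real"
  proof -
    have "bivector_apply (wedge v w) (Dual \<phi>) (Dual \<psi>) = 0"
      using \<open>wedge v w = 0\<close> by (simp add: zero_bivector.rep_eq)
    then show ?thesis
      using that by (simp add: wedge.rep_eq Dual_inverse)
  qed
  show "v = 0 \<or> w \<in> span {v}"
  proof (rule ccontr)
    assume "\<not> (v = 0 \<or> w \<in> span {v})"
    then have "v \<noteq> 0" and w: "w \<notin> span {v}" by auto
    then have "independent {w, v}"
      by (intro independent_insertI) (auto simp: independent_empty)
    moreover have "w \<noteq> v" using w by (auto intro: span_base)
    ultimately obtain \<phi> \<psi> :: "'a \<Rightarrow> real" where "linear \<phi>" "\<phi> v = 1" "\<phi> w = 0"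
        "linear \<psi>" "\<psi> v = 0" "\<psi> w = 1"
      using linear_independent_extend[of "{w, v}" "\<lambda>x. if x = v then 1 else 0 :: real"]
            linear_independent_extend[of "{w, v}" "\<lambda>x. if x = w then 1 else 0 :: real"]
      by auto
    then show False using W[of \<phi> \<psi>] by simp
  qed
next
  assume "v = 0 \<or> w \<in> span {v}"
  then show "wedge v w = 0"
    by (auto simp: span_singleton wedge_self bilinear_lzero[OF bilinear_wedge]
        bilinear_rmul[OF bilinear_wedge])
qed

definition wedge_subspaces :: "'v::real_vector set \<Rightarrow> 'v set \<Rightarrow> 'v bivector set" where
  "wedge_subspaces S T = span {wedge v w | v w. v \<in> S \<and> w \<in> T}"

section \<open>Domains in the integer lattice\<close>

definition edge :: "(int ^ 'n) set \<Rightarrow> int ^ 'n \<Rightarrow> int ^ 'n \<Rightarrow> bool" where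
  "edge \<Sigma> i j \<longleftrightarrow> i \<in> \<Sigma> \<and> j \<in> \<Sigma> \<and> (\<exists>m. j = i + axis m 1 \<or> i = j + axis m 1)"

text \<open>
  The signs \<open>a\<close> and \<open>b\<close> allow every cyclic labelling of an elementary square: any vertex may be
  \<open>i\<close>, and both orientations occur.
\<close>

definition quadrilateral ::
    "(int ^ 'n) set \<Rightarrow> int ^ 'n \<Rightarrow> int ^ 'n \<Rightarrow> int ^ 'n \<Rightarrow> int ^ 'n \<Rightarrow> bool" where
  "quadrilateral \<Sigma> i j k l \<longleftrightarrow> {i, j, k, l} \<subseteq> \<Sigma> \<and>
     (\<exists>m n a b. m \<noteq> n \<and> a \<in> {1, -1} \<and> b \<in> {1, -1} \<and>
        j = i + axis m a \<and> k = i + axis m a + axis n b \<and> l = i + axis n b)"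

definition edge_path :: "(int ^ 'n) set \<Rightarrow> (int ^ 'n) list \<Rightarrow> bool" where
  "edge_path \<Sigma> p \<longleftrightarrow> p \<noteq> [] \<and> set p \<subseteq> \<Sigma> \<and> successively (edge \<Sigma>) p"

inductive path_move :: "(int ^ 'n) set \<Rightarrow> (int ^ 'n) list \<Rightarrow> (int ^ 'n) list \<Rightarrow> bool"
  for \<Sigma> where
  back_and_forth: "edge \<Sigma> i j \<Longrightarrow> path_move \<Sigma> (p @ [i] @ q) (p @ [i, j, i] @ q)"
| across: "quadrilateral \<Sigma> i j k l \<Longrightarrow> path_move \<Sigma> (p @ [k, l, i] @ q) (p @ [k, j, i] @ q)"

definition lattice_simply_connected :: "(int ^ 'n) set \<Rightarrow> bool" where
  "lattice_simply_connected \<Sigma> \<longleftrightarrow>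
     (\<forall>i\<in>\<Sigma>. \<forall>j\<in>\<Sigma>. \<exists>p. edge_path \<Sigma> p \<and> hd p = i \<and> last p = j) \<and>
     (\<forall>p q. edge_path \<Sigma> p \<and> edge_path \<Sigma> q \<and> hd p = hd q \<and> last p = last q \<longrightarrow>
        equivclp (path_move \<Sigma>) p q)"

section \<open>Discrete forms\<close>

text \<open>The value \<open>\<alpha>\<^bsub>ji\<^esub>\<close> of a \<open>1\<close>-form on the edge oriented from \<open>i\<close> to \<open>j\<close> is \<open>\<alpha> j i\<close>.\<close>

definition one_form :: "(int ^ 'n) set \<Rightarrow> (int ^ 'n \<Rightarrow> int ^ 'n \<Rightarrow> 'w::real_vector) \<Rightarrow> bool" where
  "one_form \<Sigma> \<alpha> \<longleftrightarrow> (\<forall>i j. edge \<Sigma> i j \<longrightarrow> \<alpha> j i = - \<alpha> i j)"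

definition closed_form ::
    "(int ^ 'n) set \<Rightarrow> (int ^ 'n \<Rightarrow> int ^ 'n \<Rightarrow> 'w::real_vector) \<Rightarrow> bool" where
  "closed_form \<Sigma> \<alpha> \<longleftrightarrow>
     (\<forall>i j k l. quadrilateral \<Sigma> i j k l \<longrightarrow> \<alpha> i l + \<alpha> l k + \<alpha> k j + \<alpha> j i = 0)"

definition differential ::
    "(int ^ 'n \<Rightarrow> 'w::real_vector) \<Rightarrow> int ^ 'n \<Rightarrow> int ^ 'n \<Rightarrow> 'w" where
  "differential f j i = f j - f i"

definition curlywedge :: "(int ^ 'n \<Rightarrow> int ^ 'n \<Rightarrow> 'v::real_vector) \<Rightarrow> (int ^ 'n \<Rightarrow> 'v) \<Rightarrow>
    int ^ 'n \<Rightarrow> int ^ 'n \<Rightarrow> 'v bivector"  (infixl "\<curlywedge>" 70) where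
  "(\<alpha> \<curlywedge> f) j i = wedge (\<alpha> j i) ((1/2) *\<^sub>R (f i + f j))"

section \<open>Koenigs nets and Koenigs duals\<close>

definition projective_space :: "'v::real_vector set set" where
  "projective_space = {L. subspace L \<and> dim L = 1}"

definition regular :: "(int ^ 'n) set \<Rightarrow> (int ^ 'n \<Rightarrow> 'v::real_vector set) \<Rightarrow> bool" where
  "regular \<Sigma> s \<longleftrightarrow> (\<forall>i j k l. quadrilateral \<Sigma> i j k l \<longrightarrow>
     distinct [s i, s j, s k, s l] \<and> dim (span (s i \<union> s j \<union> s k \<union> s l)) \<ge> 3)"

definition koenigs_form :: "(int ^ 'n) set \<Rightarrow> (int ^ 'n \<Rightarrow> 'v::real_vector set) \<Rightarrow>
    (int ^ 'n \<Rightarrow> int ^ 'n \<Rightarrow> 'v bivector) \<Rightarrow> bool" where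
  "koenigs_form \<Sigma> s \<eta> \<longleftrightarrow> one_form \<Sigma> \<eta> \<and> closed_form \<Sigma> \<eta> \<and>
     (\<forall>i j. edge \<Sigma> i j \<longrightarrow> \<eta> j i \<noteq> 0 \<and> \<eta> j i \<in> wedge_subspaces (s j) (s i))"

definition koenigs :: "(int ^ 'n) set \<Rightarrow> (int ^ 'n \<Rightarrow> 'v::real_vector set) \<Rightarrow> bool" where
  "koenigs \<Sigma> s \<longleftrightarrow> (\<exists>\<eta>. koenigs_form \<Sigma> s \<eta>)"

definition affine_hyperplane :: "'v::real_vector dual \<Rightarrow> 'v set" where
  "affine_hyperplane \<alpha> = {v. dual_apply \<alpha> v = -1}"

definition affine_lift :: "(int ^ 'n) set \<Rightarrow> (int ^ 'n \<Rightarrow> 'v::real_vector set) \<Rightarrow>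
    'v dual \<Rightarrow> (int ^ 'n \<Rightarrow> 'v) \<Rightarrow> bool" where
  "affine_lift \<Sigma> s \<alpha> F \<longleftrightarrow> (\<forall>i\<in>\<Sigma>. F i \<in> s i \<and> F i \<in> affine_hyperplane \<alpha>)"

text \<open>
  Besides the factor \<open>c\<close>, the increment of \<open>G\<close> itself is required to be non-zero; this only
  matters where \<open>F\<close> is constant on an edge. Such an edge cannot lie on a quadrilateral of a
  regular map, but regularity does not rule it out on an edge that bounds no quadrilateral, and
  there a Koenigs form would have to vanish.
\<close>

definition edge_parallel ::
    "(int ^ 'n) set \<Rightarrow> (int ^ 'n \<Rightarrow> 'v::real_vector) \<Rightarrow> (int ^ 'n \<Rightarrow> 'v) \<Rightarrow> bool" where
  "edge_parallel \<Sigma> F G \<longleftrightarrow> (\<forall>i j. edge \<Sigma> i j \<longrightarrow>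
     (\<exists>c::real. c \<noteq> 0 \<and> differential G i j = c *\<^sub>R differential F i j) \<and>
     differential G i j \<noteq> 0)"

definition koenigs_dual :: "(int ^ 'n) set \<Rightarrow> 'v::real_vector dual \<Rightarrow>
    (int ^ 'n \<Rightarrow> 'v) \<Rightarrow> (int ^ 'n \<Rightarrow> 'v) \<Rightarrow> bool" where
  "koenigs_dual \<Sigma> \<alpha> F G \<longleftrightarrow>
     (\<forall>i\<in>\<Sigma>. G i \<in> affine_hyperplane \<alpha>) \<and>
     edge_parallel \<Sigma> F G \<and>
     (\<forall>i j k l. quadrilateral \<Sigma> i j k l \<longrightarrow>
        wedge (F k - F i) (G l - G j) = 0 \<and> wedge (F l - F j) (G k - G i) = 0)"

end

theory Submission
  imports Defs
begin

text \<open>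
  Fix a functional \<open>\<alpha>\<close> that is non-zero on every line \<open>s\<^sub>i\<close>. It exists because there are only countably
  many lines (\<open>ex_dual_nonzero_on_countable\<close>), and it gives an affine lift \<open>F\<close>. On an edge, a
  bivector in \<open>s\<^sub>j \<and> s\<^sub>i\<close> is a multiple \<open>\<eta>\<^bsub>ji\<^esub> = c\<^bsub>ji\<^esub> F\<^sub>j \<and> F\<^sub>i\<close>, and contracting it with \<open>\<alpha>\<close> gives
  \<open>\<omega>\<^bsub>ji\<^esub> = c\<^bsub>ji\<^esub> (F\<^sub>j - F\<^sub>i)\<close>. Contraction is linear, so \<open>\<omega>\<close> is closed when \<open>\<eta>\<close> is. On a simply connected
  domain \<open>\<omega> = dG\<close> (\<open>closed_form_exact\<close>), where \<open>G\<close> can be placed in the same affine hyperplane as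
  \<open>F\<close> because \<open>\<omega>\<close> has values in the kernel of \<open>\<alpha>\<close>. By construction \<open>G\<close> is edge-parallel to \<open>F\<close>.
  Conversely, if \<open>dG\<^bsub>ji\<^esub> = c dF\<^bsub>ji\<^esub>\<close>, then \<open>dG \<curlywedge> F\<close> takes the value \<open>c F\<^sub>j \<and> F\<^sub>i\<close> on the edge
  (\<open>curlywedge_parallel\<close>), so passing from \<open>\<eta>\<close> to \<open>G\<close> is undone by \<open>G \<mapsto> dG \<curlywedge> F\<close>.

  What remains is the relation between closedness and the diagonals. The sum of \<open>dG \<curlywedge> F\<close> around a
  quadrilateral is half of
  \<open>(G\<^sub>k - G\<^sub>i) \<and> (F\<^sub>j - F\<^sub>l) + (G\<^sub>l - G\<^sub>j) \<and> (F\<^sub>k - F\<^sub>i)\<close> (\<open>curlywedge_differential_sum\<close>).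
  If the opposite diagonals are parallel, both terms vanish and \<open>dG \<curlywedge> F\<close> is closed. If only the sum
  is known to vanish, regularity separates the two terms: contracting the closedness relation of
  \<open>\<eta>\<close> with a functional that kills \<open>F\<^sub>i\<close> and \<open>F\<^sub>k\<close> but not both of \<open>F\<^sub>j\<close> and \<open>F\<^sub>l\<close> shows that the
  products of the coefficients on opposite edges agree (\<open>bivector_relation_coefficients\<close>), and
  comparing the two ways of travelling from \<open>G\<^sub>i\<close> to \<open>G\<^sub>k\<close> then shows that \<open>G\<^sub>k - G\<^sub>i\<close> is parallel
  to \<open>F\<^sub>j - F\<^sub>l\<close>, except if all four coefficients are the same; in that case the two terms of the sum
  are equal, so that each of them vanishes (\<open>diagonal_parallel\<close>).
\<close>

section \<open>Linear functionals and bivectors\<close>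

lemmas dual_apply_linear [simp] =
  linear_add[OF linear_dual_apply] linear_diff[OF linear_dual_apply]
  linear_scale[OF linear_dual_apply] linear_neg[OF linear_dual_apply]
  linear_0[OF linear_dual_apply]

lemma ex_dual_vanishing_on:
  fixes x :: "'v::real_vector"
  assumes "x \<notin> span S"
  obtains \<phi> where "\<And>y. y \<in> S \<Longrightarrow> dual_apply \<phi> y = 0" and "dual_apply \<phi> x = 1"
proof -
  obtain B where B: "B \<subseteq> S" "independent B" "S \<subseteq> span B"
    using maximal_independent_subset[of S] by blast
  have "x \<notin> span B"
    using assms B(1) span_mono by blast
  then have "independent (insert x B)" and "x \<notin> B"
    using B(2) independent_insertI[of x B] by (auto intro: span_base)
  then obtain g :: "'v \<Rightarrow> real"
    where g: "linear g" "\<And>y. y \<in> insert x B \<Longrightarrow> g y = (if y = x then 1 else 0)"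
    using linear_independent_extend[of "insert x B" "\<lambda>y. if y = x then 1 else 0 :: real"]
    by blast
  have "g y = 0" if "y \<in> S" for y
    by (rule linear_eq_0_on_span[OF g(1), of B]) (use g(2) \<open>x \<notin> B\<close> B(3) that in auto)
  then show thesis
    using that[of "Dual g"] g by (simp add: Dual_inverse)
qed

lemma dual_separates_points:
  assumes "\<And>\<phi>. dual_apply \<phi> x = 0"
  shows "x = 0"
  using ex_dual_vanishing_on[of x "{}"] assms by (metis span_empty singletonD zero_neq_one)

text \<open>
  A vector is non-zero exactly if its coordinates are the coefficients of a non-zero polynomial,
  and evaluating that polynomial at \<open>t\<close> is a linear functional. Each of the given vectors is
  thus killed for finitely many \<open>t\<close> only, and countably many finite sets do not exhaust the
  reals.
\<close>

lemma ex_dual_nonzero_on_countable: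
  fixes C :: "'v::real_vector set"
  assumes fin_dim: "\<exists>B :: 'v set. finite B \<and> span B = UNIV"
    and "countable C" and "0 \<notin> C"
  obtains \<phi> where "\<And>v. v \<in> C \<Longrightarrow> dual_apply \<phi> v \<noteq> 0"
proof -
  obtain A :: "'v set" where A: "finite A" "span A = UNIV"
    using fin_dim by blast
  obtain B where B: "B \<subseteq> A" "independent B" "A \<subseteq> span B"
    using maximal_independent_subset[of A] by blast
  have "span B = UNIV"
    using A(2) span_mono[OF B(3)] by (simp add: span_span subset_antisym)
  with A(1) B have B: "finite B" "independent B" "span B = UNIV"
    by (auto intro: finite_subset)
  obtain h n where h: "bij_betw h {..<n::nat} B"
    using B(1) ex_bij_betw_nat_finite[of B] by (metis atLeast0LessThan)
  define g where "g t v = (\<Sum>m<n. representation B v (h m) * t ^ m)" for t :: real and v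
  have lin: "linear (g t)" for t
    by (rule linearI)
      (simp_all add: g_def representation_add representation_scale B sum.distrib
        sum_distrib_left algebra_simps)
  have roots: "finite {t. g t v = 0}" if "v \<in> C" for v
  proof -
    have "v \<noteq> 0"
      using that assms(3) by blast
    have "\<exists>m<n. representation B v (h m) \<noteq> 0"
    proof (rule ccontr)
      assume "\<not> ?thesis"
      then have "representation B v b = 0" if "b \<in> B" for b
        using h that by (metis bij_betw_iff_bijections lessThan_iff)
      then have "(\<Sum>b\<in>B. representation B v b *\<^sub>R b) = 0"
        by simp
      then show False
        using \<open>v \<noteq> 0\<close> sum_representation_eq[of B v B] B by simp
    qed
    then obtain m where m: "m < n" "representation B v (h m) \<noteq> 0"
      by blast
    define c where "c m = (if m < n then representation B v (h m) else 0)" for m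
    have "g t v = (\<Sum>i\<le>n. c i * t ^ i)" for t
      unfolding g_def c_def by (rule sum.mono_neutral_cong_left) auto
    moreover have "finite {t. (\<Sum>i\<le>n. c i * t ^ i) = 0}"
      using m by (intro polyfun_rootbound_finite exI[of _ m]) (auto simp: c_def)
    ultimately show ?thesis
      by simp
  qed
  have "countable (\<Union>v\<in>C. {t. g t v = 0})"
    using assms(2) roots by (intro countable_UN) (auto intro: countable_finite)
  then obtain t where "t \<notin> (\<Union>v\<in>C. {t. g t v = 0})"
    using uncountable_UNIV_real by (metis UNIV_eq_I)
  then show thesis
    using that[of "Dual (g t)"] lin by (auto simp: Dual_inverse)
qed

lemma bivector_eqI:
  assumes "\<And>\<phi> \<psi>. bivector_apply \<omega> \<phi> \<psi> = bivector_apply \<theta> \<phi> \<psi>"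
  shows "\<omega> = \<theta>"
  using assms by (simp add: bivector_apply_inject[symmetric] fun_eq_iff)

lemmas bivector_rep_eqs =
  wedge.rep_eq zero_bivector.rep_eq plus_bivector.rep_eq uminus_bivector.rep_eq
  minus_bivector.rep_eq scaleR_bivector.rep_eq

lemma wedge_subspaces_span_singletons:
  "wedge_subspaces (span {v}) (span {w}) = span {wedge v w}"
proof (rule antisym)
  show "wedge_subspaces (span {v}) (span {w}) \<subseteq> span {wedge v w}"
    unfolding wedge_subspaces_def
    by (rule span_minimal[OF _ subspace_span])
      (auto simp: span_singleton bilinear_lmul[OF bilinear_wedge] bilinear_rmul[OF bilinear_wedge])
  show "span {wedge v w} \<subseteq> wedge_subspaces (span {v}) (span {w})"
    unfolding wedge_subspaces_def by (rule span_mono) (auto intro: span_base)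
qed

text \<open>
  An affine hyperplane that misses the origin meets each line through the origin at most once, so
  two distinct points of it are linearly independent.
\<close>

lemma wedge_nonzero_in_affine_hyperplane:
  assumes "v \<in> affine_hyperplane \<alpha>" "w \<in> affine_hyperplane \<alpha>" "v \<noteq> w"
  shows "wedge v w \<noteq> 0"
  using assms unfolding affine_hyperplane_def
  by (auto simp: wedge_eq_0_iff span_singleton)

lemma line_span_singleton:
  assumes "L \<in> projective_space"
  obtains v where "v \<noteq> 0" "L = span {v}"
proof -
  have L: "subspace L" "dim L = 1"
    using assms by (auto simp: projective_space_def)
  obtain B where B: "B \<subseteq> L" "independent B" "L \<subseteq> span B" "card B = dim L"
    by (rule basis_exists)
  then obtain v where "B = {v}"
    using L(2) by (metis card_1_singletonE)
  then show thesis
    using that[of v] B L(1) by (metis dependent_zero insertI1 span_minimal subset_antisym)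
qed

lemma line_span_member:
  assumes "L \<in> projective_space" "v \<in> L" "v \<noteq> 0"
  shows "L = span {v}"
proof -
  obtain w where "L = span {w}"
    using assms(1) by (rule line_span_singleton)
  moreover from this obtain c where "v = c *\<^sub>R w"
    using assms(2) by (auto simp: span_singleton)
  moreover have "c \<noteq> 0"
    using assms(3) calculation(2) by auto
  ultimately show ?thesis
    by (simp add: span_image_scale[of "{w}" "\<lambda>_. c", simplified])
qed

section \<open>The Poincare lemma on a simply connected domain\<close>

fun path_sum :: "('a \<Rightarrow> 'a \<Rightarrow> 'w::real_vector) \<Rightarrow> 'a list \<Rightarrow> 'w" where
  "path_sum \<omega> (i # j # p) = \<omega> j i + path_sum \<omega> (j # p)"
| "path_sum \<omega> _ = 0"

lemma path_sum_append: "path_sum \<omega> (p @ [i] @ q) = path_sum \<omega> (p @ [i]) + path_sum \<omega> (i # q)"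
  by (induction \<omega> p rule: path_sum.induct) (auto simp: add.assoc)

lemma path_sum_snoc: "p \<noteq> [] \<Longrightarrow> path_sum \<omega> (p @ [j]) = path_sum \<omega> p + \<omega> j (last p)"
  by (induction \<omega> p rule: path_sum.induct) (auto simp: add.assoc)

lemma quadrilateral_rotate: "quadrilateral \<Sigma> i j k l \<Longrightarrow> quadrilateral \<Sigma> j k l i"
proof -
  assume "quadrilateral \<Sigma> i j k l"
  then obtain m n a b where *: "{i, j, k, l} \<subseteq> \<Sigma>" "m \<noteq> n" "a \<in> {1, -1::int}" "b \<in> {1, -1::int}"
    "j = i + axis m a" "k = i + axis m a + axis n b" "l = i + axis n b"
    unfolding quadrilateral_def by blast
  have "axis m (- a) = - axis m a"
    by (simp add: vec_eq_iff axis_def)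
  then have "k = j + axis n b" "l = j + axis n b + axis m (- a)" "i = j + axis m (- a)"
    using * by (simp_all add: algebra_simps)
  moreover have "n \<noteq> m" "- a \<in> {1, -1}" "{j, k, l, i} \<subseteq> \<Sigma>"
    using * by auto
  ultimately show ?thesis
    unfolding quadrilateral_def using *(4) by blast
qed

lemma quadrilateral_first_edge: "quadrilateral \<Sigma> i j k l \<Longrightarrow> edge \<Sigma> i j"
proof -
  assume "quadrilateral \<Sigma> i j k l"
  then obtain m a where *: "i \<in> \<Sigma>" "j \<in> \<Sigma>" "a \<in> {1, -1::int}" "j = i + axis m a"
    unfolding quadrilateral_def by blast
  have "axis m (- 1 :: int) = - axis m 1"
    by (simp add: vec_eq_iff axis_def)
  then show ?thesis
    using * unfolding edge_def by auto
qed

lemma quadrilateral_edges: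
  assumes "quadrilateral \<Sigma> i j k l"
  shows "edge \<Sigma> i j" "edge \<Sigma> j k" "edge \<Sigma> k l" "edge \<Sigma> l i"
proof -
  note 1 = quadrilateral_rotate[OF assms]
  note 2 = quadrilateral_rotate[OF 1]
  note 3 = quadrilateral_rotate[OF 2]
  show "edge \<Sigma> i j" "edge \<Sigma> j k" "edge \<Sigma> k l" "edge \<Sigma> l i"
    using quadrilateral_first_edge[OF assms] quadrilateral_first_edge[OF 1]
      quadrilateral_first_edge[OF 2] quadrilateral_first_edge[OF 3] by simp_all
qed

lemma edge_sym: "edge \<Sigma> i j \<Longrightarrow> edge \<Sigma> j i"
  by (auto simp: edge_def)

text \<open>
  A step and its reverse cancel by antisymmetry, and the two ways across a quadrilateral agree by
  closedness.
\<close>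

lemma path_sum_path_move:
  assumes "one_form \<Sigma> \<omega>" "closed_form \<Sigma> \<omega>" "path_move \<Sigma> p q"
  shows "path_sum \<omega> p = path_sum \<omega> q"
  using assms(3)
proof cases
  case (back_and_forth i j p' q')
  then have "\<omega> j i + \<omega> i j = 0"
    using assms(1) by (simp add: one_form_def)
  then show ?thesis
    using path_sum_append[of \<omega> p' i q'] path_sum_append[of \<omega> p' i "[j, i] @ q'"] back_and_forth
    by (simp add: add.assoc[symmetric])
next
  case (across i j k l p' q')
  then have "\<omega> i l + \<omega> l k + \<omega> k j + \<omega> j i = 0"
    using assms(2) by (simp add: closed_form_def)
  moreover have "\<omega> k j = - \<omega> j k" "\<omega> j i = - \<omega> i j"
    using quadrilateral_edges[OF across(3)] assms(1) edge_sym unfolding one_form_def by blast+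
  ultimately have "\<omega> l k + \<omega> i l = \<omega> j k + \<omega> i j"
    by (simp add: algebra_simps)
  then show ?thesis
    using path_sum_append[of \<omega> p' k "[l, i] @ q'"] path_sum_append[of \<omega> p' k "[j, i] @ q'"] across
    by (simp add: add.assoc[symmetric])
qed

lemma path_sum_homotopic:
  assumes "one_form \<Sigma> \<omega>" "closed_form \<Sigma> \<omega>" "equivclp (path_move \<Sigma>) p q"
  shows "path_sum \<omega> p = path_sum \<omega> q"
  using assms(3)
  by (induction rule: equivclp_induct) (auto dest: path_sum_path_move[OF assms(1,2)])

lemma edge_path_snoc:
  assumes "edge_path \<Sigma> p" "edge \<Sigma> (last p) j"
  shows "edge_path \<Sigma> (p @ [j])"
  using assms by (auto simp: edge_path_def successively_append_iff edge_def)

text \<open>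
  The primitive is the integral along paths from a base point. Extending a path to \<open>i\<close> by the edge
  to \<open>j\<close> gives a path to \<open>j\<close>, and by simple connectedness it has the same integral as the path
  chosen for \<open>j\<close>.
\<close>

lemma closed_form_exact:
  assumes "lattice_simply_connected \<Sigma>" "one_form \<Sigma> \<omega>" "closed_form \<Sigma> \<omega>"
  obtains f where "\<And>i j. edge \<Sigma> i j \<Longrightarrow> differential f j i = \<omega> j i"
proof -
  \<comment> \<open>The base point; if the domain is empty, there is no edge to integrate over.\<close>
  define z where "z = (SOME i. i \<in> \<Sigma>)"
  define path where "path j = (SOME p. edge_path \<Sigma> p \<and> hd p = z \<and> last p = j)" for j
  have path: "edge_path \<Sigma> (path j) \<and> hd (path j) = z \<and> last (path j) = j" if "j \<in> \<Sigma>" for j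
  proof -
    have "z \<in> \<Sigma>"
      using that unfolding z_def by (rule someI)
    then have "\<exists>p. edge_path \<Sigma> p \<and> hd p = z \<and> last p = j"
      using assms(1) that unfolding lattice_simply_connected_def by blast
    then show ?thesis
      unfolding path_def by (rule someI_ex)
  qed
  have "path_sum \<omega> (path j) - path_sum \<omega> (path i) = \<omega> j i" if "edge \<Sigma> i j" for i j
  proof -
    have ij: "i \<in> \<Sigma>" "j \<in> \<Sigma>"
      using that by (auto simp: edge_def)
    have ne: "path i \<noteq> []"
      using path[OF ij(1)] by (auto simp: edge_path_def)
    have "edge_path \<Sigma> (path i @ [j])"
      using path[OF ij(1)] that by (auto intro: edge_path_snoc)
    then have "equivclp (path_move \<Sigma>) (path j) (path i @ [j])"
      using assms(1) path[OF ij(1)] path[OF ij(2)] ne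
      unfolding lattice_simply_connected_def by simp
    then have "path_sum \<omega> (path j) = path_sum \<omega> (path i @ [j])"
      by (rule path_sum_homotopic[OF assms(2,3)])
    then show ?thesis
      using path_sum_snoc[OF ne, of \<omega> j] path[OF ij(1)] by simp
  qed
  then show thesis
    using that[of "\<lambda>j. path_sum \<omega> (path j)"] by (simp add: differential_def)
qed

lemma constant_along_edge_path:
  assumes "edge_path \<Sigma> p" "\<And>i j. edge \<Sigma> i j \<Longrightarrow> f i = f j"
  shows "f (hd p) = f (last p)"
  using assms(1)
proof (induction p rule: induct_list012)
  case (3 i j p)
  then have "edge \<Sigma> i j" "edge_path \<Sigma> (j # p)"
    by (auto simp: edge_path_def)
  then show ?case
    using 3 assms(2)[of i j] by simp
qed (auto simp: edge_path_def)

section \<open>Quadrilaterals\<close>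

text \<open>
  Collecting the terms of the left-hand side by the values of \<open>G\<close> leaves half of \<open>G\<^sub>i \<and> (F\<^sub>l - F\<^sub>j)\<close> for the
  vertex \<open>i\<close> and the analogous term for each other vertex; opposite vertices come with opposite
  second factors.
\<close>

lemma curlywedge_differential_sum:
  "(differential G \<curlywedge> F) i l + (differential G \<curlywedge> F) l k + (differential G \<curlywedge> F) k j +
     (differential G \<curlywedge> F) j i =
   (1/2) *\<^sub>R (wedge (G k - G i) (F j - F l) + wedge (G l - G j) (F k - F i))"
  by (rule bivector_eqI)
    (simp add: curlywedge_def differential_def bivector_rep_eqs algebra_simps)

text \<open>
  The midpoint in the definition of \<open>\<curlywedge>\<close> is what makes this work:
  \<open>(F\<^sub>j - F\<^sub>i) \<and> (F\<^sub>i + F\<^sub>j) / 2 = F\<^sub>j \<and> F\<^sub>i\<close>.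
\<close>

lemma curlywedge_parallel:
  assumes "differential G j i = c *\<^sub>R differential F j i"
  shows "(differential G \<curlywedge> F) j i = c *\<^sub>R wedge (F j) (F i)"
  unfolding curlywedge_def assms
  by (rule bivector_eqI)
    (simp add: differential_def bivector_rep_eqs algebra_simps)

text \<open>
  The contraction of \<open>v \<and> w\<close> with \<open>\<phi>\<close> is \<open>\<phi>(v) w - \<phi>(w) v\<close>, and it is recognised by its values under
  all functionals \<open>\<psi>\<close>, which are the values of the bivector at \<open>(\<phi>, \<psi>)\<close>.
\<close>

lemma bivector_relation_contract:
  assumes "c1 *\<^sub>R wedge b a + c2 *\<^sub>R wedge c b + c3 *\<^sub>R wedge d c + c4 *\<^sub>R wedge a d = 0"
  shows "c1 *\<^sub>R (dual_apply \<phi> b *\<^sub>R a - dual_apply \<phi> a *\<^sub>R b) +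
    c2 *\<^sub>R (dual_apply \<phi> c *\<^sub>R b - dual_apply \<phi> b *\<^sub>R c) +
    c3 *\<^sub>R (dual_apply \<phi> d *\<^sub>R c - dual_apply \<phi> c *\<^sub>R d) +
    c4 *\<^sub>R (dual_apply \<phi> a *\<^sub>R d - dual_apply \<phi> d *\<^sub>R a) = 0"
    (is "?x = 0")
proof (rule dual_separates_points)
  fix \<psi>
  have "dual_apply \<psi> ?x = bivector_apply (c1 *\<^sub>R wedge b a + c2 *\<^sub>R wedge c b +
      c3 *\<^sub>R wedge d c + c4 *\<^sub>R wedge a d) \<phi> \<psi>"
    by (simp add: bivector_rep_eqs algebra_simps)
  then show "dual_apply \<psi> ?x = 0"
    by (simp add: assms bivector_rep_eqs)
qed

text \<open>
  Contracting the relation with a functional that vanishes on \<open>a\<close> and \<open>c\<close>, and takes the values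
  \<open>p\<close> on \<open>b\<close> and \<open>q\<close> on \<open>d\<close>, leaves a relation between the independent vectors \<open>a\<close> and \<open>c\<close>. Its
  coefficients give \<open>c1 p = c4 q\<close> and \<open>c3 q = c2 p\<close>, and the rank condition allows a choice in
  which \<open>p\<close> and \<open>q\<close> do not both vanish. As \<open>c1\<close> and \<open>c4\<close> are non-zero, \<open>p\<close> is then non-zero
  and can be cancelled.
\<close>

lemma bivector_relation_coefficients:
  assumes rel: "c1 *\<^sub>R wedge b a + c2 *\<^sub>R wedge c b + c3 *\<^sub>R wedge d c + c4 *\<^sub>R wedge a d = 0"
    and ac: "wedge a c \<noteq> 0"
    and rank: "\<not> {b, d} \<subseteq> span {a, c}"
    and "c1 \<noteq> 0" "c4 \<noteq> 0"
  shows "c2 * c4 = c1 * c3"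
proof -
  obtain x where "x \<in> {b, d}" "x \<notin> span {a, c}"
    using rank by blast
  then obtain \<phi> where \<phi>: "dual_apply \<phi> a = 0" "dual_apply \<phi> c = 0"
      "dual_apply \<phi> b \<noteq> 0 \<or> dual_apply \<phi> d \<noteq> 0"
    using ex_dual_vanishing_on[of x "{a, c}"] by (metis insertCI insertE singletonD zero_neq_one)
  define p q where "p = dual_apply \<phi> b" and "q = dual_apply \<phi> d"
  have *: "(c1 * p - c4 * q) *\<^sub>R a + (c3 * q - c2 * p) *\<^sub>R c = 0"
    using bivector_relation_contract[OF rel, of \<phi>] \<phi>
    by (simp add: p_def q_def algebra_simps)
  \<comment> \<open>Wedging with \<open>c\<close> and with \<open>a\<close> isolates the two coefficients.\<close>
  have "wedge ((c1 * p - c4 * q) *\<^sub>R a + (c3 * q - c2 * p) *\<^sub>R c) c = (c1 * p - c4 * q) *\<^sub>R wedge a c"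
    "wedge a ((c1 * p - c4 * q) *\<^sub>R a + (c3 * q - c2 * p) *\<^sub>R c) = (c3 * q - c2 * p) *\<^sub>R wedge a c"
    by (rule bivector_eqI, simp add: bivector_rep_eqs algebra_simps)+
  then have "c1 * p = c4 * q" "c3 * q = c2 * p"
    using ac unfolding * by (simp_all add: bilinear_lzero[OF bilinear_wedge] 
      bilinear_rzero[OF bilinear_wedge])
  moreover from this have "p \<noteq> 0"
    using \<phi>(3) assms(4,5) unfolding p_def q_def by auto
  moreover have "(c2 * c4) * p = (c1 * c3) * p"
    using calculation(1,2) by (metis mult.assoc mult.commute)
  ultimately show ?thesis
    by simp
qed

text \<open>
  The vectors \<open>a, b, c, d\<close> are the values of \<open>F\<close> around a quadrilateral, and \<open>P\<close> and \<open>Q\<close> are the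
  diagonals of \<open>G\<close>. Put \<open>t = c2 / c1 = c3 / c4\<close>. The two expressions for \<open>P\<close> then read
  \<open>P / c1 = (b - a) + t (c - b)\<close> and \<open>P / c4 = (d - a) + t (c - d)\<close>, and their difference is
  \<open>(1 - t) (b - d)\<close>. For \<open>t = 1\<close> this says nothing about \<open>b - d\<close>; but then all four coefficients
  coincide, \<open>P\<close> and \<open>Q\<close> are the same multiple of \<open>c - a\<close> and \<open>d - b\<close> respectively, and the two terms of the
  relation between the diagonals are equal.
\<close>

lemma diagonal_parallel:
  fixes a b c d P Q :: "'v::real_vector"
  assumes P: "P = c1 *\<^sub>R (b - a) + c2 *\<^sub>R (c - b)" "P = c3 *\<^sub>R (c - d) + c4 *\<^sub>R (d - a)"
    and Q: "Q = c2 *\<^sub>R (c - b) + c3 *\<^sub>R (d - c)"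
    and PQ: "wedge P (b - d) + wedge Q (c - a) = 0"
    and c: "c2 * c4 = c1 * c3" "c1 \<noteq> 0" "c4 \<noteq> 0"
    and "a \<noteq> c"
  shows "wedge P (b - d) = 0"
proof -
  define t where "t = c2 / c1"
  have t: "c2 = t * c1" "c3 = t * c4"
    using c by (auto simp: t_def field_simps)
  have "(c4 - c1) *\<^sub>R P = c4 *\<^sub>R (c1 *\<^sub>R (b - a) + c2 *\<^sub>R (c - b)) - c1 *\<^sub>R (c3 *\<^sub>R (c - d) + c4 *\<^sub>R (d - a))"
    by (simp only: P[symmetric] scaleR_diff_left)
  also have "\<dots> = ((1 - t) * c1 * c4) *\<^sub>R (b - d)"
    by (simp add: t algebra_simps)
  finally have *: "(c4 - c1) *\<^sub>R P = ((1 - t) * c1 * c4) *\<^sub>R (b - d)" .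
  show ?thesis
  proof (cases "t = 1")
    case False
    then have K: "(1 - t) * c1 * c4 \<noteq> 0"
      using c by simp
    have "((1 - t) * c1 * c4) *\<^sub>R wedge P (b - d) = wedge P ((c4 - c1) *\<^sub>R P)"
      unfolding * by (simp add: bilinear_rmul[OF bilinear_wedge])
    also have "\<dots> = 0"
      by (simp add: bilinear_rmul[OF bilinear_wedge] wedge_self)
    finally show ?thesis
      using K by simp
  next
    case True
    have P1: "P = c1 *\<^sub>R (c - a)"
      using P(1) t True by (simp add: algebra_simps)
    have "P = c4 *\<^sub>R (c - a)"
      using P(2) t True by (simp add: algebra_simps)
    then have "c1 *\<^sub>R (c - a) = c4 *\<^sub>R (c - a)"
      by (rule trans[OF P1[symmetric]])
    then have "c1 = c4"
      using \<open>a \<noteq> c\<close> by auto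
    then have Q1: "Q = c1 *\<^sub>R (d - b)"
      using Q t True by (simp add: algebra_simps)
    have "wedge P (b - d) + wedge Q (c - a) = 2 *\<^sub>R wedge P (b - d)"
      unfolding P1 Q1 by (intro bivector_eqI) (simp add: bivector_rep_eqs algebra_simps)
    then show ?thesis
      using PQ by simp
  qed
qed

section \<open>Koenigs nets and Koenigs duals\<close>

text \<open>
  Edge-parallelism makes the form a non-zero multiple of \<open>F\<^sub>j \<and> F\<^sub>i\<close> on each edge, and parallelism
  of opposite diagonals makes it closed.
\<close>

lemma koenigs_form_of_dual:
  assumes lift: "affine_lift \<Sigma> s \<alpha> F" and dual: "koenigs_dual \<Sigma> \<alpha> F G"
  shows "koenigs_form \<Sigma> s (differential G \<curlywedge> F)"
proof -
  have "one_form \<Sigma> (differential G \<curlywedge> F)"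
    unfolding one_form_def
    by (intro allI impI bivector_eqI)
      (simp add: curlywedge_def differential_def bivector_rep_eqs algebra_simps)
  moreover have "closed_form \<Sigma> (differential G \<curlywedge> F)"
    unfolding closed_form_def
  proof (intro allI impI)
    fix i j k l
    assume quad: "quadrilateral \<Sigma> i j k l"
    have "wedge (F l - F j) (G k - G i) = 0" "wedge (F k - F i) (G l - G j) = 0"
      using dual quad by (auto simp: koenigs_dual_def)
    moreover have "wedge (G k - G i) (F j - F l) = wedge (F l - F j) (G k - G i)"
      "wedge (G l - G j) (F k - F i) = - wedge (F k - F i) (G l - G j)"
      by (rule bivector_eqI, simp add: bivector_rep_eqs algebra_simps)+
    ultimately show "(differential G \<curlywedge> F) i l + (differential G \<curlywedge> F) l k +
        (differential G \<curlywedge> F) k j + (differential G \<curlywedge> F) j i = 0"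
      unfolding curlywedge_differential_sum by simp
  qed
  moreover have "(differential G \<curlywedge> F) j i \<noteq> 0 \<and>
      (differential G \<curlywedge> F) j i \<in> wedge_subspaces (s j) (s i)" if e: "edge \<Sigma> i j" for i j
  proof -
    have F: "F i \<in> s i" "F j \<in> s j" "F i \<in> affine_hyperplane \<alpha>" "F j \<in> affine_hyperplane \<alpha>"
      using lift that by (auto simp: affine_lift_def edge_def)
    obtain c where c: "c \<noteq> 0" "differential G j i = c *\<^sub>R differential F j i"
        "differential G j i \<noteq> 0"
      using dual edge_sym[OF e] unfolding koenigs_dual_def edge_parallel_def by blast
    have "F j \<noteq> F i"
      using c by (auto simp: differential_def)
    moreover have "wedge (F j) (F i) \<in> wedge_subspaces (s j) (s i)"
      unfolding wedge_subspaces_def using F by (auto intro: span_base)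
    ultimately show ?thesis
      using c wedge_nonzero_in_affine_hyperplane[OF F(4,3)]
      by (simp add: curlywedge_parallel[OF c(2)] wedge_subspaces_def span_scale)
  qed
  ultimately show ?thesis
    by (simp add: koenigs_form_def)
qed

lemma ex_affine_lift:
  fixes s :: "int ^ 'n \<Rightarrow> 'v::real_vector set"
  assumes fin_dim: "\<exists>B :: 'v set. finite B \<and> span B = UNIV"
    and map: "\<forall>i\<in>\<Sigma>. s i \<in> projective_space"
  obtains \<alpha> F where "affine_lift \<Sigma> s \<alpha> F"
proof -
  have "\<exists>v. v \<noteq> 0 \<and> v \<in> s i" if "i \<in> \<Sigma>" for i
    using map that by (metis line_span_singleton singletonI span_base)
  then obtain v where v: "\<And>i. i \<in> \<Sigma> \<Longrightarrow> v i \<noteq> 0 \<and> v i \<in> s i"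
    by metis
  have "countable (UNIV :: (int ^ 'n) set)"
    using countable_vector[of "\<lambda>_. UNIV :: int set"] by simp
  then have "countable (v ` \<Sigma>)"
    by (meson countable_image countable_subset subset_UNIV)
  moreover have "0 \<notin> v ` \<Sigma>"
    using v by auto
  ultimately obtain \<alpha> where \<alpha>: "\<And>x. x \<in> v ` \<Sigma> \<Longrightarrow> dual_apply \<alpha> x \<noteq> 0"
    using ex_dual_nonzero_on_countable[OF fin_dim, of "v ` \<Sigma>"] by blast
  have "affine_lift \<Sigma> s \<alpha> (\<lambda>i. (- 1 / dual_apply \<alpha> (v i)) *\<^sub>R v i)"
    using map v \<alpha>
    by (auto simp: affine_lift_def affine_hyperplane_def projective_space_def
        intro!: subspace_neg subspace_scale)
  then show thesis
    by (rule that)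
qed

text \<open>
  Along an edge, the values of a primitive under \<open>\<alpha>\<close> do not change, so on a connected domain
  they are all equal, and one translation moves the primitive into the hyperplane. The function
  \<open>F\<close> serves only to provide a point of the hyperplane.
\<close>

lemma ex_primitive_in_affine_hyperplane:
  assumes "lattice_simply_connected \<Sigma>" "one_form \<Sigma> \<omega>" "closed_form \<Sigma> \<omega>"
    and kernel: "\<And>i j. edge \<Sigma> i j \<Longrightarrow> dual_apply \<alpha> (\<omega> j i) = 0"
    and base: "\<And>i. i \<in> \<Sigma> \<Longrightarrow> F i \<in> affine_hyperplane \<alpha>"
  obtains G where "\<And>i. i \<in> \<Sigma> \<Longrightarrow> G i \<in> affine_hyperplane \<alpha>"
    and "\<And>i j. edge \<Sigma> i j \<Longrightarrow> differential G j i = \<omega> j i"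
proof -
  obtain f where f: "\<And>i j. edge \<Sigma> i j \<Longrightarrow> differential f j i = \<omega> j i"
    using closed_form_exact[OF assms(1-3)] by blast
  define z where "z = (SOME i. i \<in> \<Sigma>)"
  define G where "G i = f i + (F z - f z)" for i
  have step: "dual_apply \<alpha> (f i) = dual_apply \<alpha> (f j)" if "edge \<Sigma> i j" for i j
  proof -
    have "dual_apply \<alpha> (f j - f i) = 0"
      using f[OF that] kernel[OF that] by (simp add: differential_def)
    then show ?thesis
      by simp
  qed
  have const: "dual_apply \<alpha> (f i) = dual_apply \<alpha> (f z)" and z: "z \<in> \<Sigma>" if "i \<in> \<Sigma>" for i
  proof -
    show "z \<in> \<Sigma>"
      unfolding z_def using that by (rule someI)
    with \<open>i \<in> \<Sigma>\<close> obtain p where p: "edge_path \<Sigma> p" "hd p = i" "last p = z"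
      using assms(1) unfolding lattice_simply_connected_def by blast
    show "dual_apply \<alpha> (f i) = dual_apply \<alpha> (f z)"
      using constant_along_edge_path[OF p(1), of "\<lambda>i. dual_apply \<alpha> (f i)", OF step] p(2,3) by simp
  qed
  have "G i \<in> affine_hyperplane \<alpha>" if "i \<in> \<Sigma>" for i
    using base[OF z[OF that]] const[OF that] by (simp add: G_def affine_hyperplane_def)
  then show thesis
    using that[of G] f by (simp add: G_def differential_def)
qed

text \<open>
  Otherwise all four lines would lie in the span of two vectors, which has dimension at most two.
\<close>

lemma regular_lift_rank:
  assumes lines: "\<And>x. x \<in> {i, j, k, l} \<Longrightarrow> s x = span {F x}"
    and dim: "dim (span (s i \<union> s j \<union> s k \<union> s l)) \<ge> 3"
  shows "\<not> {F j, F l} \<subseteq> span {F i, F k}"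
proof
  assume "{F j, F l} \<subseteq> span {F i, F k}"
  then have "F x \<in> span {F i, F k}" if "x \<in> {i, j, k, l}" for x
    using that by (auto intro: span_base)
  then have "s x \<subseteq> span {F i, F k}" if "x \<in> {i, j, k, l}" for x
    unfolding lines[OF that] using that by (intro span_minimal) auto
  then have "span (s i \<union> s j \<union> s k \<union> s l) \<subseteq> span {F i, F k}"
    by (intro span_minimal) auto
  then have "dim (span (s i \<union> s j \<union> s k \<union> s l)) \<le> card {F i, F k}"
    by (intro dim_le_card) auto
  then show False
    using dim card_insert_le_m1[of 2 "{F k}" "F i"] by simp
qed

text \<open>
  The dual is a primitive of the contraction \<open>\<omega>\<close> of \<open>\<eta>\<close> with \<open>\<alpha>\<close>. The lift is arbitrary: a Koenigs
  net has a Koenigs dual for each of its affine lifts.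
\<close>

lemma ex_koenigs_dual:
  fixes s :: "int ^ 'n \<Rightarrow> 'v::real_vector set"
  assumes simply_conn: "lattice_simply_connected \<Sigma>"
    and map: "\<forall>i\<in>\<Sigma>. s i \<in> projective_space"
    and reg: "regular \<Sigma> s"
    and form: "koenigs_form \<Sigma> s \<eta>"
    and lift: "affine_lift \<Sigma> s \<alpha> F"
  obtains G where "koenigs_dual \<Sigma> \<alpha> F G"
proof -
  have F: "dual_apply \<alpha> (F i) = - 1" "F i \<in> affine_hyperplane \<alpha>" "s i = span {F i}" if "i \<in> \<Sigma>" for i
  proof -
    show *: "dual_apply \<alpha> (F i) = - 1" "F i \<in> affine_hyperplane \<alpha>"
      using lift that by (auto simp: affine_lift_def affine_hyperplane_def)
    then have "F i \<noteq> 0"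
      by auto
    then show "s i = span {F i}"
      using lift map that by (intro line_span_member) (auto simp: affine_lift_def)
  qed
  define c where "c j i = (SOME t. \<eta> j i = t *\<^sub>R wedge (F j) (F i))" for j i
  have multiple: "\<exists>c. \<eta> j i = c *\<^sub>R wedge (F j) (F i)" if "edge \<Sigma> i j" for i j
  proof -
    have "\<eta> j i \<in> wedge_subspaces (s j) (s i)"
      using form that by (auto simp: koenigs_form_def)
    moreover have "s i = span {F i}" "s j = span {F j}"
      using that F(3) by (auto simp: edge_def)
    ultimately have "\<eta> j i \<in> span {wedge (F j) (F i)}"
      by (simp add: wedge_subspaces_span_singletons)
    then show ?thesis
      by (auto simp: span_singleton)
  qed
  have \<eta>: "\<eta> j i = c j i *\<^sub>R wedge (F j) (F i)" if "edge \<Sigma> i j" for i j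
    unfolding c_def by (rule someI_ex[OF multiple[OF that]])
  have nonzero: "c j i \<noteq> 0" "F j \<noteq> F i" if "edge \<Sigma> i j" for i j
    using form that \<eta>[OF that] by (auto simp: koenigs_form_def wedge_self)
  have sym: "c i j = c j i" if "edge \<Sigma> i j" for i j
  proof -
    have "\<eta> i j = - \<eta> j i"
      using form edge_sym[OF that] by (simp add: koenigs_form_def one_form_def)
    then have "c i j *\<^sub>R wedge (F i) (F j) = - (c j i *\<^sub>R wedge (F j) (F i))"
      using \<eta>[OF that] \<eta>[OF edge_sym[OF that]] by simp
    moreover have "- (c j i *\<^sub>R wedge (F j) (F i)) = c j i *\<^sub>R wedge (F i) (F j)"
      by (rule bivector_eqI) (simp add: bivector_rep_eqs algebra_simps)
    moreover have "wedge (F i) (F j) \<noteq> 0"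
      using F(2) nonzero(2)[OF edge_sym[OF that]] that
      by (intro wedge_nonzero_in_affine_hyperplane) (auto simp: edge_def)
    ultimately show ?thesis
      by simp
  qed
  have relation: "c j i *\<^sub>R wedge (F j) (F i) + c k j *\<^sub>R wedge (F k) (F j) +
      c l k *\<^sub>R wedge (F l) (F k) + c i l *\<^sub>R wedge (F i) (F l) = 0"
    if "quadrilateral \<Sigma> i j k l" for i j k l
  proof -
    have "\<eta> i l + \<eta> l k + \<eta> k j + \<eta> j i = 0"
      using form that by (simp add: koenigs_form_def closed_form_def)
    then show ?thesis
      using quadrilateral_edges[OF that] by (simp add: \<eta> add_ac)
  qed

  \<comment> \<open>The contraction of \<open>\<eta>\<close> with \<open>\<alpha>\<close>, because \<open>\<alpha>(F\<^sub>i) = -1\<close>.\<close>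
  define \<omega> where "\<omega> j i = c j i *\<^sub>R (F j - F i)" for j i
  have "one_form \<Sigma> \<omega>"
    unfolding one_form_def \<omega>_def
    by (metis minus_diff_eq scaleR_minus_right sym)
  moreover have "closed_form \<Sigma> \<omega>"
    unfolding closed_form_def
  proof (intro allI impI)
    fix i j k l
    assume quad: "quadrilateral \<Sigma> i j k l"
    then have "{i, j, k, l} \<subseteq> \<Sigma>"
      by (simp add: quadrilateral_def)
    then show "\<omega> i l + \<omega> l k + \<omega> k j + \<omega> j i = 0"
      using bivector_relation_contract[OF relation[OF quad], of \<alpha>] F(1)
      by (simp add: \<omega>_def add_ac)
  qed
  moreover have "dual_apply \<alpha> (\<omega> j i) = 0" if "edge \<Sigma> i j" for i j
    using that F(1) by (simp add: \<omega>_def edge_def)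
  ultimately obtain G where G: "\<And>i. i \<in> \<Sigma> \<Longrightarrow> G i \<in> affine_hyperplane \<alpha>"
    "\<And>i j. edge \<Sigma> i j \<Longrightarrow> differential G j i = \<omega> j i"
    using ex_primitive_in_affine_hyperplane[OF simply_conn, of \<omega> \<alpha> F] F(2) by blast
  have eq_\<eta>: "(differential G \<curlywedge> F) j i = c j i *\<^sub>R wedge (F j) (F i)" if "edge \<Sigma> i j" for i j
    using G(2)[OF that] by (intro curlywedge_parallel) (simp add: \<omega>_def differential_def)
  have "edge_parallel \<Sigma> F G"
    unfolding edge_parallel_def
  proof (intro allI impI)
    fix i j
    assume "edge \<Sigma> i j"
    then have "edge \<Sigma> j i"
      by (rule edge_sym)
    then show "(\<exists>c. c \<noteq> 0 \<and> differential G i j = c *\<^sub>R differential F i j) \<and> differential G i j \<noteq> 0"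
      using nonzero[of j i] G(2)[of j i] by (auto simp: \<omega>_def differential_def)
  qed
  \<comment> \<open>It suffices to treat one pair of diagonals: closedness says that the two wedges cancel.\<close>
  moreover have "wedge (F k - F i) (G l - G j) = 0 \<and> wedge (F l - F j) (G k - G i) = 0"
    if quad: "quadrilateral \<Sigma> i j k l" for i j k l
  proof -
    note edges = quadrilateral_edges[OF quad]
    have in_\<Sigma>: "{i, j, k, l} \<subseteq> \<Sigma>"
      using quad by (simp add: quadrilateral_def)
    have lines: "s x = span {F x}" if "x \<in> {i, j, k, l}" for x
      using that in_\<Sigma> F(3) by blast
    have "s i \<noteq> s k" and dim: "dim (span (s i \<union> s j \<union> s k \<union> s l)) \<ge> 3"
      using reg quad by (auto simp: regular_def)
    then have "F i \<noteq> F k"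
      using lines by auto
    then have "wedge (F i) (F k) \<noteq> 0"
      using in_\<Sigma> F(2) by (intro wedge_nonzero_in_affine_hyperplane) auto
    then have coeff: "c k j * c i l = c j i * c l k"
      using bivector_relation_coefficients[OF relation[OF quad] _ regular_lift_rank[OF lines dim]]
        nonzero(1) edges by blast
    have dG: "G j - G i = c j i *\<^sub>R (F j - F i)" "G k - G j = c k j *\<^sub>R (F k - F j)"
        "G l - G k = c l k *\<^sub>R (F l - F k)" "G i - G l = c i l *\<^sub>R (F i - F l)"
      using G(2) edges by (simp_all add: \<omega>_def differential_def)
    have "(differential G \<curlywedge> F) i l + (differential G \<curlywedge> F) l k + (differential G \<curlywedge> F) k j +
        (differential G \<curlywedge> F) j i = 0"
      using relation[OF quad] edges by (simp add: eq_\<eta> add_ac)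
    then have sum: "wedge (G k - G i) (F j - F l) + wedge (G l - G j) (F k - F i) = 0"
      unfolding curlywedge_differential_sum by simp
    have P1: "G k - G i = c j i *\<^sub>R (F j - F i) + c k j *\<^sub>R (F k - F j)"
      and Q: "G l - G j = c k j *\<^sub>R (F k - F j) + c l k *\<^sub>R (F l - F k)"
      unfolding dG[symmetric] by simp_all
    have "c l k *\<^sub>R (F k - F l) + c i l *\<^sub>R (F l - F i) = - (G l - G k) - (G i - G l)"
      unfolding dG by (simp add: algebra_simps)
    then have P2: "G k - G i = c l k *\<^sub>R (F k - F l) + c i l *\<^sub>R (F l - F i)"
      by simp
    have "wedge (G k - G i) (F j - F l) = 0"
      using nonzero(1) edges \<open>F i \<noteq> F k\<close>
      by (intro diagonal_parallel[OF P1 P2 Q sum coeff]) auto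
    moreover have "wedge (F l - F j) (G k - G i) = wedge (G k - G i) (F j - F l)"
      "wedge (F k - F i) (G l - G j) = - wedge (G l - G j) (F k - F i)"
      by (rule bivector_eqI, simp add: bivector_rep_eqs algebra_simps)+
    ultimately show ?thesis
      using sum by simp
  qed
  ultimately have "koenigs_dual \<Sigma> \<alpha> F G"
    using G(1) by (simp add: koenigs_dual_def)
  then show thesis
    by (rule that)
qed

theorem proposition3p4:
  fixes \<Sigma> :: "(int ^ 'n) set" and s :: "int ^ 'n \<Rightarrow> 'v::real_vector set"
  assumes fin_dim: "\<exists>B :: 'v set. finite B \<and> span B = UNIV"
    and simply_conn: "lattice_simply_connected \<Sigma>"
    and map: "\<forall>i\<in>\<Sigma>. s i \<in> projective_space"
    and reg: "regular \<Sigma> s"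
  shows "(koenigs \<Sigma> s \<longleftrightarrow>
           (\<exists>\<alpha> F G. affine_lift \<Sigma> s \<alpha> F \<and> koenigs_dual \<Sigma> \<alpha> F G)) \<and>
         (\<forall>\<alpha> F G. affine_lift \<Sigma> s \<alpha> F \<and> koenigs_dual \<Sigma> \<alpha> F G \<longrightarrow>
           koenigs_form \<Sigma> s (differential G \<curlywedge> F))"
proof -
  have "\<exists>\<alpha> F G. affine_lift \<Sigma> s \<alpha> F \<and> koenigs_dual \<Sigma> \<alpha> F G" if "koenigs \<Sigma> s"
  proof -
    obtain \<eta> where "koenigs_form \<Sigma> s \<eta>"
      using \<open>koenigs \<Sigma> s\<close> by (auto simp: koenigs_def)
    moreover obtain \<alpha> F where "affine_lift \<Sigma> s \<alpha> F"
      using ex_affine_lift[OF fin_dim map] by blast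
    ultimately show ?thesis
      using ex_koenigs_dual[OF simply_conn map reg] by blast
  qed
  then show ?thesis
    using koenigs_form_of_dual unfolding koenigs_def by blast
qed

end
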